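(* Let $r\ge2$, $l\ge r$, and $\mathcal{U}=\{K^{(r)}_r,K^{(r)}_{r+1},\ldots,K^{(r)}_l\}$. Then $$\operatorname{trop}(\mathcal{G}_\mathcal{U})=\Big\{\mathbf y\in\mathbb{R}^{l-r+1}:\ y_{K^{(r)}_r}\le0,\ \ (r+i)\,y_{K^{(r)}_{r+i-1}}-(r+i-1)\,y_{K^{(r)}_{r+i}}\ge0\ \text{ for all } 1\le i\le l-r\Big\}.$$ Moreover, the extreme rays of $\operatorname{trop}(\mathcal{G}_\mathcal{U})$ are $\mathbf u_i=-\sum_{j=i}^{l-r+1}(r+j-1)\mathbf 1_{K^{(r)}_{r+j-1}}$ for $1\le i\le l-r+1$.
   Context: $K^{(r)}_p$ is the complete $r$-uniform hypergraph on $p$ vertices (every $r$-set is an edge). Homomorphism densities of $r$-uniform hypergraphs: $t(H;G)$ is the number of maps $\varphi:V(H)\to V(G)$ with $\{\varphi(u_1),\dots,\varphi(u_r)\}\in E(G)$ for every edge $\{u_1,\dots,u_r\}$ of $H$, divided by $|V(G)|^{|V(H)|}$. $\mathcal{G}_\mathcal{U}\subseteq\mathbb{R}^{l-r+1}$ is the closure of the set of vectors $(t(K^{(r)}_r;G),\ldots,t(K^{(r)}_l;G))$ over all $r$-uniform hypergraphs $G$; coordinates are indexed by $K^{(r)}_r,\ldots,K^{(r)}_l$, $y_{K}$ is the coordinate indexed by $K$ and $\mathbf 1_K$ the corresponding standard basis vector. $\operatorname{trop}(\mathcal S)$ is the set of $\mathbf y$ such that there exist $\tau_k\in(0,1)$,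 $\tau_k\to0$, and $\mathbf y(k)\in\mathcal S\cap\mathbb{R}^{l-r+1}_{>0}$ with $\frac{-1}{\log_e\tau_k}(\log_e y(k)_1,\ldots)\to\mathbf y$. *)

theory Defs
  imports "HOL-Analysis.Analysis"
begin

record 'v hypergraph =
  verts :: "'v set"
  edges :: "'v set set"

definition uniform_hypergraph :: "nat \<Rightarrow> 'v hypergraph \<Rightarrow> bool" where
  "uniform_hypergraph r G \<longleftrightarrow>
     finite (verts G) \<and> verts G \<noteq> {} \<and> (\<forall>e\<in>edges G. e \<subseteq> verts G \<and> card e = r)"

definition complete_hypergraph :: "nat \<Rightarrow> nat \<Rightarrow> nat hypergraph" where
  "complete_hypergraph r p =
     \<lparr>verts = {..<p}, edges = {e. e \<subseteq> {..<p} \<and> card e = r}\<rparr>"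

definition hypergraph_homs :: "'u hypergraph \<Rightarrow> 'v hypergraph \<Rightarrow> ('u \<Rightarrow> 'v) set" where
  "hypergraph_homs H G = {\<phi> \<in> verts H \<rightarrow>\<^sub>E verts G. \<forall>e\<in>edges H. \<phi> ` e \<in> edges G}"

definition hom_density :: "'u hypergraph \<Rightarrow> 'v hypergraph \<Rightarrow> real" where
  "hom_density H G =
     real (card (hypergraph_homs H G)) / real (card (verts G)) ^ card (verts H)"

(* The family U is indexed by the finite type 'n. Every finite hypergraph is isomorphic
   to one with vertices in nat, so G may be restricted to that vertex type. *)
definition density_profile :: "nat \<Rightarrow> ('n::finite \<Rightarrow> 'u hypergraph) \<Rightarrow> (real ^ 'n) set" where
  "density_profile r U =
     closure {(\<chi> i. hom_density (U i) G) | G :: nat hypergraph. uniform_hypergraph r G}"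

definition trop :: "(real ^ 'n::finite) set \<Rightarrow> (real ^ 'n) set" where
  "trop S = {y. \<exists>(\<tau> :: nat \<Rightarrow> real) (Y :: nat \<Rightarrow> real ^ 'n).
     (\<forall>k. 0 < \<tau> k \<and> \<tau> k < 1) \<and> \<tau> \<longlonglongrightarrow> 0 \<and>
     (\<forall>k. Y k \<in> S \<and> (\<forall>i. 0 < Y k $ i)) \<and>
     (\<lambda>k. (- 1 / ln (\<tau> k)) *\<^sub>R (\<chi> i. ln (Y k $ i))) \<longlonglongrightarrow> y}"

definition extreme_ray_of :: "'a::real_vector set \<Rightarrow> 'a set \<Rightarrow> bool" where
  "extreme_ray_of R C \<longleftrightarrow> (\<exists>u. u \<noteq> 0 \<and> R = conic hull {u}) \<and> R face_of C"

end

theory Submission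
  imports Defs "HOL-Library.Sublist"
begin

text \<open>
  Let \<open>N\<^sub>p\<close> be the number of ordered \<open>p\<close>-cliques of an \<open>r\<close>-graph on \<open>n\<close> vertices, so that the clique
  densities are \<open>t\<^sub>p = N\<^sub>p / n\<^sup>p\<close>. Splitting a clique into its first vertex and a clique in the link of
  that vertex yields \<open>N\<^sub>p\<^sub>+\<^sub>1 ^ p \<le> N\<^sub>p ^ (p + 1)\<close> by induction on \<open>p\<close>, and taking logarithms gives the
  inequalities of the cone.

  Conversely, write a point of the cone as \<open>y\<^sub>p = - p z\<^sub>p\<close> with \<open>0 \<le> z\<^sub>r \<le> \<dots> \<le> z\<^sub>l\<close>. Give every vertex a
  colour below \<open>l\<close>, and superimpose for each \<open>q\<close> a complete \<open>q\<close>-partite \<open>r\<close>-graph on the first \<open>m\<^sub>q\<close>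
  vertices of each colour below \<open>q\<close>, where \<open>m\<^sub>q / n\<close> is about \<open>\<tau> powr z\<^sub>q\<close>. A \<open>p\<close>-clique uses a colour
  of at least \<open>p - 1\<close>, hence only edges with \<open>q \<ge> p\<close>, so \<open>t\<^sub>p\<close> is \<open>\<tau> powr (p z\<^sub>p)\<close> up to a constant factor.

  In the coordinates \<open>z\<^sub>r, z\<^sub>r\<^sub>+\<^sub>1 - z\<^sub>r, \<dots>, z\<^sub>l - z\<^sub>l\<^sub>-\<^sub>1\<close> the cone is the nonnegative orthant, and the
  \<open>\<^bold>u\<^sub>i\<close> are the basis dual to these coordinates.
\<close>

subsection \<open>Clique densities\<close>

text \<open>A weak Kruskal-Katona bound. Families closed under subsequences are used instead of the
  cliques of an \<open>r\<close>-graph because a nonempty link of a vertex is again such a family,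
  which keeps the induction within one class.\<close>

lemma card_lists_power_le:
  fixes S :: "'a list set"
  assumes "finite V" and "S \<noteq> {}" and "\<And>xs. xs \<in> S \<Longrightarrow> set xs \<subseteq> V"
    and "\<And>xs ys. ys \<in> S \<Longrightarrow> subseq xs ys \<Longrightarrow> xs \<in> S"
  shows "card {xs \<in> S. length xs = Suc p} ^ p \<le> card {xs \<in> S. length xs = p} ^ Suc p"
  using assms(2-)
proof (induction p arbitrary: S)
  case 0
  then have "[] \<in> S"
    by (metis equals0I list_emb_Nil)
  then have "{xs \<in> S. length xs = 0} = {[]}"
    by auto
  then show ?case by simp
next
  case (Suc q)
  \<comment> \<open>For each vertex \<open>v\<close>, multiply the induction hypothesis for its link by \<open>N\<^sub>p(lk v) \<le> N\<^sub>p(S)\<close>, where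
    \<open>p = q + 1\<close>, and take \<open>p\<close>-th roots: \<open>N\<^sub>p(lk v) \<le> N\<^sub>p\<^sub>-\<^sub>1(lk v) c\<close> with \<open>c\<close> independent of \<open>v\<close>.
    Summing over \<open>v\<close> gives \<open>N\<^sub>p\<^sub>+\<^sub>1(S) \<le> N\<^sub>p(S) c\<close>.\<close>
  define lk where "lk v = {xs. v # xs \<in> S}" for v
  define N where "N p T = card {xs \<in> T. length xs = p}" for p and T :: "'a list set"
  define c where "c = root (Suc q) (N (Suc q) S)"
  have fin: "finite {xs \<in> T. length xs = p}" if "T \<subseteq> S" for p T
    by (rule finite_subset[OF _ finite_lists_length_eq[OF \<open>finite V\<close>, of p]])
       (use that Suc.prems(2) in auto)
  have lk_sub: "lk v \<subseteq> S" for v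
    unfolding lk_def using Suc.prems(3) by (auto intro: list_emb_Cons)
  have N_Suc: "N (Suc p) S = (\<Sum>v\<in>V. N p (lk v))" for p
  proof -
    have "{xs \<in> S. length xs = Suc p} = (\<Union>v\<in>V. (#) v ` {xs \<in> lk v. length xs = p})"
    proof (intro equalityI subsetI)
      fix xs assume "xs \<in> {xs \<in> S. length xs = Suc p}"
      then obtain v ys where "xs = v # ys" "v # ys \<in> S" "length ys = p"
        by (cases xs) auto
      moreover from this have "v \<in> V"
        using Suc.prems(2) by fastforce
      ultimately show "xs \<in> (\<Union>v\<in>V. (#) v ` {xs \<in> lk v. length xs = p})"
        by (auto simp: lk_def)
    qed (auto simp: lk_def)
    then have "N (Suc p) S = (\<Sum>v\<in>V. card ((#) v ` {xs \<in> lk v. length xs = p}))"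
      unfolding N_def using \<open>finite V\<close> fin[OF lk_sub]
      by (simp only:) (rule card_UN_disjoint, auto)
    then show ?thesis
      by (simp add: N_def card_image)
  qed
  have link: "N (Suc q) (lk v) \<le> N q (lk v) * c" for v
  proof (cases "lk v = {}")
    case True
    then show ?thesis by (simp add: N_def)
  next
    case False
    have "N (Suc q) (lk v) ^ q \<le> N q (lk v) ^ Suc q"
      unfolding N_def
    proof (rule Suc.IH[OF False])
      show "set xs \<subseteq> V" if "xs \<in> lk v" for xs
        using Suc.prems(2) lk_sub that by blast
      show "xs \<in> lk v" if "ys \<in> lk v" "subseq xs ys" for xs ys
        using that Suc.prems(3) unfolding lk_def by (metis mem_Collect_eq subseq_Cons2)
    qed
    moreover have "N (Suc q) (lk v) \<le> N (Suc q) S"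
      unfolding N_def using lk_sub by (intro card_mono fin) auto
    ultimately have "N (Suc q) (lk v) ^ Suc q \<le> N q (lk v) ^ Suc q * N (Suc q) S"
      by (metis mult.commute mult_le_mono power_Suc2)
    then have "real (N (Suc q) (lk v)) ^ Suc q \<le> real (N q (lk v)) ^ Suc q * real (N (Suc q) S)"
      by (metis of_nat_le_iff of_nat_mult of_nat_power)
    also have "\<dots> = (N q (lk v) * c) ^ Suc q"
      unfolding c_def power_mult_distrib by (subst real_root_pow_pos2) auto
    finally show ?thesis
      by (rule power_le_imp_le_base) (simp add: c_def)
  qed
  have "real (N (Suc (Suc q)) S) \<le> (\<Sum>v\<in>V. N q (lk v) * c)"
    unfolding N_Suc of_nat_sum by (intro sum_mono link)
  also have "\<dots> = N (Suc q) S * c"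
    by (simp add: N_Suc sum_distrib_right)
  \<comment> \<open>Since \<open>c ^ Suc q\<close> is \<open>N (Suc q) S\<close>, this power removes
    the root and returns the claim to natural numbers.\<close>
  finally have "real (N (Suc (Suc q)) S) ^ Suc q \<le> (N (Suc q) S * c) ^ Suc q"
    by (rule power_mono) simp
  also have "\<dots> = real (N (Suc q) S) ^ Suc (Suc q)"
    unfolding c_def power_mult_distrib by (subst real_root_pow_pos2) auto
  finally show ?case
    unfolding N_def by (simp only: of_nat_power[symmetric] of_nat_le_iff)
qed

section \<open>Homomorphisms from complete hypergraphs as ordered cliques\<close>

text \<open>The condition on \<open>r\<close>-subsets is inherited by subsequences and is vacuous
  for lists shorter than \<open>r\<close>, so this is the kind of family that the counting bound is
  about.\<close>

definition clique_lists :: "nat \<Rightarrow> 'v hypergraph \<Rightarrow> 'v list set" where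
  "clique_lists r G = {xs. set xs \<subseteq> verts G \<and> distinct xs \<and>
     (\<forall>e. e \<subseteq> set xs \<longrightarrow> card e = r \<longrightarrow> e \<in> edges G)}"

text \<open>Used to turn conditions on edges into conditions on pairs of vertices; the case
  \<open>i = j\<close> is included.\<close>

lemma obtain_edge_through_pair:
  assumes "2 \<le> r" "r \<le> p" "i < p" "j < p"
  obtains e where "e \<in> edges (complete_hypergraph r p)" "i \<in> e" "j \<in> e"
proof -
  have "card {i, j} \<le> r"
    using assms(1) by (cases "i = j") auto
  then obtain e where "{i, j} \<subseteq> e" "e \<subseteq> {..<p}" "card e = r"
    using exists_subset_between[of "{i, j}" r "{..<p}"] assms by auto
  then show ?thesis
    by (intro that[of e]) (auto simp: complete_hypergraph_def)
qed

text \<open>The image of an edge is an edge and so has \<open>r\<close> elements again; hence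
  \<open>\<phi>\<close> is injective on every edge, and any two vertices share one.\<close>

lemma hom_inj_on:
  assumes "uniform_hypergraph r G" "2 \<le> r" "r \<le> p"
    and "\<phi> \<in> hypergraph_homs (complete_hypergraph r p) G"
  shows "inj_on \<phi> {..<p}"
proof (rule inj_onI)
  fix i j assume ij: "i \<in> {..<p}" "j \<in> {..<p}" "\<phi> i = \<phi> j"
  then obtain e where e: "e \<in> edges (complete_hypergraph r p)" "i \<in> e" "j \<in> e"
    using obtain_edge_through_pair[OF assms(2,3)] by (metis lessThan_iff)
  then have "finite e" "card e = r" "\<phi> ` e \<in> edges G"
    using assms(4)
    by (auto simp: hypergraph_homs_def complete_hypergraph_def intro: finite_subset)
  moreover from this have "card (\<phi> ` e) = r"
    using assms(1) by (simp add: uniform_hypergraph_def)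
  ultimately have "inj_on \<phi> e"
    by (simp add: eq_card_imp_inj_on)
  then show "i = j"
    using e ij by (auto dest: inj_onD)
qed

text \<open>A homomorphism corresponds to its list of values. Injectivity makes the list distinct
  and makes every \<open>r\<close>-subset of the values the image of an edge.\<close>

lemma card_homs_eq_card_clique_lists:
  assumes "uniform_hypergraph r G" "2 \<le> r" "r \<le> p"
  shows "card (hypergraph_homs (complete_hypergraph r p) G)
       = card {xs \<in> clique_lists r G. length xs = p}"
proof (rule bij_betw_same_card)
  let ?H = "hypergraph_homs (complete_hypergraph r p) G"
  let ?L = "{xs \<in> clique_lists r G. length xs = p}"
  show "bij_betw (\<lambda>\<phi>. map \<phi> [0..<p]) ?H ?L"
  proof (rule bij_betw_byWitness[where f' = "\<lambda>xs. \<lambda>i\<in>{..<p}. xs ! i"])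
    show "\<forall>\<phi>\<in>?H. (\<lambda>i\<in>{..<p}. map \<phi> [0..<p] ! i) = \<phi>"
      by (auto simp: hypergraph_homs_def complete_hypergraph_def PiE_def extensional_def)
    show "\<forall>xs\<in>?L. map (\<lambda>i\<in>{..<p}. xs ! i) [0..<p] = xs"
      by (auto intro!: nth_equalityI)
    show "(\<lambda>\<phi>. map \<phi> [0..<p]) ` ?H \<subseteq> ?L"
    proof (rule image_subsetI)
      fix \<phi> assume \<phi>: "\<phi> \<in> ?H"
      have inj: "inj_on \<phi> {..<p}"
        using hom_inj_on[OF assms \<phi>] .
      have "e \<in> edges G" if "e \<subseteq> \<phi> ` {..<p}" "card e = r" for e
      proof -
        obtain d where d: "d \<subseteq> {..<p}" "e = \<phi> ` d"
          using \<open>e \<subseteq> _\<close> by (meson subset_imageE)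
        then have "card d = r"
          using inj that(2) by (metis card_image inj_on_subset)
        then show ?thesis
          using \<phi> d by (auto simp: hypergraph_homs_def complete_hypergraph_def)
      qed
      moreover have "\<phi> ` {..<p} \<subseteq> verts G"
        using \<phi> by (auto simp: hypergraph_homs_def complete_hypergraph_def)
      ultimately show "map \<phi> [0..<p] \<in> ?L"
        using inj by (simp add: clique_lists_def distinct_map atLeast0LessThan)
    qed
    show "(\<lambda>xs. \<lambda>i\<in>{..<p}. xs ! i) ` ?L \<subseteq> ?H"
    proof (rule image_subsetI)
      fix xs assume xs: "xs \<in> ?L"
      have "(\<lambda>i\<in>{..<p}. xs ! i) ` e \<in> edges G" if e: "e \<subseteq> {..<p}" "card e = r" for e
      proof -
        have im: "(\<lambda>i\<in>{..<p}. xs ! i) ` e = (!) xs ` e"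
          using e by (intro image_cong) auto
        have "inj_on ((!) xs) e"
          using xs e by (intro inj_on_nth) (auto simp: clique_lists_def)
        then have "card ((!) xs ` e) = r"
          using e by (simp add: card_image)
        moreover have "(!) xs ` e \<subseteq> set xs"
          using xs e by auto
        ultimately show ?thesis
          using xs im by (auto simp: clique_lists_def)
      qed
      moreover have "(\<lambda>i\<in>{..<p}. xs ! i) \<in> {..<p} \<rightarrow>\<^sub>E verts G"
        using xs by (auto simp: clique_lists_def intro!: subsetD[of "set xs" "verts G"])
      ultimately show "(\<lambda>i\<in>{..<p}. xs ! i) \<in> ?H"
        by (simp add: hypergraph_homs_def complete_hypergraph_def)
    qed
  qed
qed

lemma card_verts_complete [simp]: "card (verts (complete_hypergraph r p)) = p"
  by (simp add: complete_hypergraph_def)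

text \<open>Both sides of the counting bound are divided by the same power of the number of
  vertices, with exponent \<open>p * Suc p\<close>.\<close>

lemma hom_density_clique_power_le:
  assumes "uniform_hypergraph r G" "2 \<le> r" "r \<le> p"
  shows "hom_density (complete_hypergraph r (Suc p)) G ^ p
       \<le> hom_density (complete_hypergraph r p) G ^ Suc p"
proof -
  let ?h = "\<lambda>p. card (hypergraph_homs (complete_hypergraph r p) G)"
  let ?n = "card (verts G)"
  have "?h (Suc p) ^ p \<le> ?h p ^ Suc p"
    unfolding card_homs_eq_card_clique_lists[OF assms]
      card_homs_eq_card_clique_lists[OF assms(1,2) le_SucI[OF assms(3)]]
  proof (rule card_lists_power_le)
    show "finite (verts G)"
      using assms by (simp add: uniform_hypergraph_def)
    have "[] \<in> clique_lists r G"
      using assms by (simp add: clique_lists_def)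
    then show "clique_lists r G \<noteq> {}"
      by auto
    show "set xs \<subseteq> verts G" if "xs \<in> clique_lists r G" for xs
      using that by (simp add: clique_lists_def)
    show "xs \<in> clique_lists r G" if "ys \<in> clique_lists r G" "subseq xs ys" for xs ys
      using that subseq_conv_nths[of xs ys] set_nths_subset[of ys] distinct_nthsI[of ys]
      unfolding clique_lists_def by blast
  qed
  then have "real (?h (Suc p)) ^ p \<le> real (?h p) ^ Suc p"
    by (metis of_nat_le_iff of_nat_power)
  moreover have "(real ?n ^ Suc p) ^ p = (real ?n ^ p) ^ Suc p"
    by (simp only: power_mult[symmetric] mult.commute)
  ultimately show ?thesis
    unfolding hom_density_def power_divide card_verts_complete
    by (metis divide_right_mono of_nat_0_le_iff zero_le_power)
qed

lemma hom_density_le_1: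
  assumes "uniform_hypergraph r G" "finite (verts H)"
  shows "hom_density H G \<le> 1"
proof -
  have "card (hypergraph_homs H G) \<le> card (verts H \<rightarrow>\<^sub>E verts G)"
    using assms by (intro card_mono finite_PiE) (auto simp: hypergraph_homs_def uniform_hypergraph_def)
  also have "\<dots> = card (verts G) ^ card (verts H)"
    using assms by (simp add: card_PiE)
  finally show ?thesis
    unfolding hom_density_def
    by (metis divide_le_eq_1 of_nat_le_iff of_nat_power of_nat_0_le_iff order_le_less)
qed

subsection \<open>Layered hypergraphs\<close>

text \<open>The vertex \<open>x\<close> has colour \<open>x mod l\<close> and height \<open>x div l\<close>.\<close>

definition layered_hypergraph :: "nat \<Rightarrow> nat \<Rightarrow> nat \<Rightarrow> (nat \<Rightarrow> nat) \<Rightarrow> nat hypergraph" where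
  "layered_hypergraph r l n m = \<lparr>verts = {..<n * l},
     edges = {e. e \<subseteq> {..<n * l} \<and> card e = r \<and> inj_on (\<lambda>x. x mod l) e \<and>
                 (\<exists>q\<in>{r..l}. \<forall>x\<in>e. x mod l < q \<and> x div l < m q)}\<rparr>"

lemma uniform_layered_hypergraph:
  assumes "0 < n" "0 < l"
  shows "uniform_hypergraph r (layered_hypergraph r l n m)"
  using assms by (auto simp: uniform_hypergraph_def layered_hypergraph_def lessThan_empty_iff)

text \<open>Some vertex of the clique has colour at least \<open>p - 1\<close>, so it shares edges
  with the others only in layers \<open>q \<ge> p\<close>. All heights are then below
  \<open>m p\<close>, which leaves at most \<open>m p * l\<close> values for each vertex.\<close>

lemma card_homs_layered_le:
  assumes "2 \<le> r" "r \<le> p" "p \<le> l" "0 < n"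
    and anti: "\<And>q. q \<in> {p..l} \<Longrightarrow> m q \<le> m p"
  shows "card (hypergraph_homs (complete_hypergraph r p) (layered_hypergraph r l n m))
       \<le> (m p * l) ^ p"
proof -
  let ?K = "complete_hypergraph r p" and ?G = "layered_hypergraph r l n m"
  have "hypergraph_homs ?K ?G \<subseteq> {..<p} \<rightarrow>\<^sub>E {..<m p * l}"
  proof
    fix \<phi> assume \<phi>: "\<phi> \<in> hypergraph_homs ?K ?G"
    have inj: "inj_on \<phi> {..<p}"
      using hom_inj_on[OF uniform_layered_hypergraph assms(1,2) \<phi>] assms by simp
    have pair: "(i \<noteq> j \<longrightarrow> \<phi> i mod l \<noteq> \<phi> j mod l) \<and>
        (\<exists>q\<in>{r..l}. \<phi> j mod l < q \<and> \<phi> i div l < m q)" if ij: "i < p" "j < p" for i j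
    proof -
      obtain e where e: "e \<in> edges ?K" "i \<in> e" "j \<in> e"
        using obtain_edge_through_pair[OF assms(1,2) ij] by blast
      then have *: "\<phi> ` e \<in> edges ?G"
        using \<phi> by (simp add: hypergraph_homs_def)
      have "i \<noteq> j \<Longrightarrow> \<phi> i \<noteq> \<phi> j"
        using inj ij by (auto dest: inj_onD)
      then show ?thesis
        using * e by (auto simp: layered_hypergraph_def inj_on_def)
    qed
    \<comment> \<open>Pigeonhole: \<open>p\<close> distinct colours do not fit into
      \<open>p - 1\<close> values.\<close>
    have "\<not> (\<lambda>i. \<phi> i mod l) ` {..<p} \<subseteq> {..<p - 1}"
    proof
      assume "(\<lambda>i. \<phi> i mod l) ` {..<p} \<subseteq> {..<p - 1}"
      moreover have "inj_on (\<lambda>i. \<phi> i mod l) {..<p}"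
        using pair by (auto simp: inj_on_def)
      ultimately have "p \<le> p - 1"
        by (metis card_inj_on_le card_lessThan finite_lessThan)
      then show False
        using assms by simp
    qed
    then obtain j where j: "j < p" "p - 1 \<le> \<phi> j mod l"
      by (metis image_subsetI lessThan_iff not_less)
    have "\<phi> i < m p * l" if i: "i < p" for i
    proof -
      obtain q where q: "q \<in> {r..l}" "\<phi> j mod l < q" "\<phi> i div l < m q"
        using pair[OF i j(1)] by blast
      \<comment> \<open>Here \<open>q\<close> exceeds a colour that is at least
        \<open>p - 1\<close>, so \<open>q \<ge> p\<close> and \<open>anti\<close> applies.\<close>
      then have "\<phi> i div l < m p"
        using anti[of q] j by fastforce
      then show ?thesis
        using assms by (simp add: div_less_iff_less_mult)
    qed
    then show "\<phi> \<in> {..<p} \<rightarrow>\<^sub>E {..<m p * l}"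
      using \<phi> by (auto simp: hypergraph_homs_def complete_hypergraph_def PiE_iff)
  qed
  then have "card (hypergraph_homs ?K ?G) \<le> card ({..<p} \<rightarrow>\<^sub>E {..<m p * l})"
    by (intro card_mono finite_PiE) auto
  then show ?thesis
    by (simp add: card_PiE)
qed

text \<open>Vertex \<open>i\<close> is sent to colour \<open>i\<close> at a freely chosen height
  \<open>f i\<close> below \<open>m p\<close>; distinct choices give distinct homomorphisms.\<close>

lemma card_homs_layered_ge:
  assumes "r \<le> p" "p \<le> l" "m p \<le> n"
  shows "m p ^ p \<le> card (hypergraph_homs (complete_hypergraph r p) (layered_hypergraph r l n m))"
proof -
  let ?K = "complete_hypergraph r p" and ?G = "layered_hypergraph r l n m"
  let ?F = "\<lambda>f. \<lambda>i\<in>{..<p}. f i * l + i"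
  have "card ({..<p} \<rightarrow>\<^sub>E {..<m p}) \<le> card (hypergraph_homs ?K ?G)"
  proof (rule card_inj_on_le)
    show "inj_on ?F ({..<p} \<rightarrow>\<^sub>E {..<m p})"
    proof (rule inj_onI)
      fix f g assume fg: "f \<in> {..<p} \<rightarrow>\<^sub>E {..<m p}" "g \<in> {..<p} \<rightarrow>\<^sub>E {..<m p}" "?F f = ?F g"
      show "f = g"
      proof (rule PiE_ext[OF fg(1,2)])
        fix i assume "i \<in> {..<p}"
        then show "f i = g i"
          using fun_cong[OF fg(3), of i] assms by auto
      qed
    qed
    show "?F ` ({..<p} \<rightarrow>\<^sub>E {..<m p}) \<subseteq> hypergraph_homs ?K ?G"
    proof (rule image_subsetI)
      fix f assume f: "f \<in> {..<p} \<rightarrow>\<^sub>E {..<m p}"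
      have dm: "?F f i mod l = i" "?F f i div l = f i" if "i < p" for i
        using that assms by auto
      have bd: "?F f i < n * l" if "i < p" for i
      proof -
        have "?F f i div l < n"
          using dm(2)[OF that] that f assms by (auto simp: PiE_iff intro: less_le_trans)
        then show ?thesis
          using that assms by (simp only: div_less_iff_less_mult)
      qed
      have "?F f ` e \<in> edges ?G" if e: "e \<subseteq> {..<p}" "card e = r" for e
      proof -
        have "inj_on (\<lambda>i. ?F f i mod l) e"
          using e dm(1) by (auto simp: inj_on_def subset_iff)
        then have inj: "inj_on (?F f) e" "inj_on (\<lambda>x. x mod l) (?F f ` e)"
          using inj_on_imageI2[of "\<lambda>x. x mod l" "?F f" e] inj_on_imageI[of "\<lambda>x. x mod l" "?F f" e]
          by (auto simp: comp_def)
        have "?F f i mod l < p \<and> ?F f i div l < m p" if "i \<in> e" for i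
          using that e f dm by auto
        \<comment> \<open>The single layer \<open>q = p\<close> contains the images of all
          edges.\<close>
        then have "\<exists>q\<in>{r..l}. \<forall>x\<in>?F f ` e. x mod l < q \<and> x div l < m q"
          using assms by (intro bexI[of _ p] ballI) (blast, simp)
        moreover have "?F f ` e \<subseteq> {..<n * l}"
          using bd e by blast
        moreover have "card (?F f ` e) = r"
          using inj(1) e(2) by (simp only: card_image)
        ultimately show ?thesis
          using inj(2) unfolding layered_hypergraph_def by (simp only: select_convs mem_Collect_eq)
      qed
      moreover have "?F f \<in> {..<p} \<rightarrow>\<^sub>E {..<n * l}"
        using bd by auto
      ultimately show "?F f \<in> hypergraph_homs ?K ?G"
        by (simp add: hypergraph_homs_def complete_hypergraph_def) (simp add: layered_hypergraph_def)
    qed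
    show "finite (hypergraph_homs ?K ?G)"
      by (rule finite_subset[of _ "{..<p} \<rightarrow>\<^sub>E {..<n * l}"])
        (auto simp: hypergraph_homs_def complete_hypergraph_def layered_hypergraph_def
          intro: finite_PiE)
  qed
  then show ?thesis
    by (simp add: card_PiE)
qed

section \<open>Asymptotics of the densities of layered hypergraphs\<close>

text \<open>The two bounds differ by the factor \<open>l ^ p\<close>, which does not depend on
  \<open>n\<close> and so disappears on the logarithmic scale.\<close>

lemma hom_density_layered_bounds:
  assumes "2 \<le> r" "r \<le> p" "p \<le> l" "0 < n" "m p \<le> n"
    and "\<And>q. q \<in> {p..l} \<Longrightarrow> m q \<le> m p"
  shows "(m p / (real n * l)) ^ p \<le> hom_density (complete_hypergraph r p) (layered_hypergraph r l n m)"
    and "hom_density (complete_hypergraph r p) (layered_hypergraph r l n m) \<le> (m p / n) ^ p"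
proof -
  let ?h = "card (hypergraph_homs (complete_hypergraph r p) (layered_hypergraph r l n m))"
  have d: "hom_density (complete_hypergraph r p) (layered_hypergraph r l n m) = ?h / (real n * l) ^ p"
    by (simp add: hom_density_def) (simp add: layered_hypergraph_def)
  have "real (m p) ^ p \<le> ?h"
    using card_homs_layered_ge[of r p l m n] assms by (metis of_nat_le_iff of_nat_power)
  then show "(m p / (real n * l)) ^ p \<le> hom_density (complete_hypergraph r p) (layered_hypergraph r l n m)"
    unfolding d power_divide by (simp add: divide_right_mono)
  have "real ?h \<le> (m p * l) ^ p"
    using card_homs_layered_le[of r p l n m] assms by (metis of_nat_le_iff of_nat_power)
  then have "?h / (real n * l) ^ p \<le> (m p * l) ^ p / (real n * l) ^ p"
    by (simp add: divide_right_mono)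
  also have "\<dots> = (m p / n) ^ p"
    using assms by (simp add: power_divide[symmetric])
  finally show "hom_density (complete_hypergraph r p) (layered_hypergraph r l n m) \<le> (m p / n) ^ p"
    unfolding d .
qed

lemma layered_density_limits:
  fixes z :: "nat \<Rightarrow> real"
  assumes "2 \<le> r" "r \<le> l" "0 \<le> z r" and mono: "mono_on {r..l} z"
  obtains G :: "nat \<Rightarrow> nat hypergraph"
  where "\<And>k. uniform_hypergraph r (G k)"
    and "\<And>k p. p \<in> {r..l} \<Longrightarrow> 0 < hom_density (complete_hypergraph r p) (G k)"
    and "\<And>p. p \<in> {r..l} \<Longrightarrow>
      (\<lambda>k. ln (hom_density (complete_hypergraph r p) (G k)) / ln (real k + 2)) \<longlonglongrightarrow> - (p * z p)"
proof -
  \<comment> \<open>The integer \<open>D\<close> is at least every \<open>z q\<close>, so with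
    \<open>n = (k + 2) ^ D\<close> the target size \<open>x k q = n * (k + 2) powr - z q\<close> is
    at least 1. Rounding it up to \<open>m k q\<close> then costs at most a factor 2, and
    \<open>m k q\<close> stays at most \<open>n\<close>.\<close>
  define D where "D = nat \<lceil>z l\<rceil>"
  define x where "x k q = (real k + 2) powr (D - z q)" for k q
  define m where "m k q = nat \<lceil>x k q\<rceil>" for k q
  define G where "G k = layered_hypergraph r l ((k + 2) ^ D) (m k)" for k
  have z: "0 \<le> z p" "z p \<le> D" if "p \<in> {r..l}" for p
  proof -
    have "z r \<le> z p" "z p \<le> z l"
      using that assms(2) by (auto intro!: mono_onD[OF mono])
    then show "0 \<le> z p" "z p \<le> D"
      using assms(3) unfolding D_def by linarith+
  qed
  have m: "x k p \<le> m k p" "m k p \<le> 2 * x k p" "m k p \<le> (k + 2) ^ D" if "p \<in> {r..l}" for k p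
  proof -
    have "1 \<le> x k p"
      unfolding x_def using z[OF that] by (intro ge_one_powr_ge_zero) auto
    then show "x k p \<le> m k p" "m k p \<le> 2 * x k p"
      unfolding m_def by linarith+
    have "x k p \<le> (real k + 2) powr D"
      unfolding x_def using z[OF that] by (intro powr_mono) auto
    also have "\<dots> = real ((k + 2) ^ D)"
      by (simp add: powr_realpow add.commute)
    finally show "m k p \<le> (k + 2) ^ D"
      unfolding m_def by linarith
  qed
  have anti: "m k q \<le> m k p" if "p \<in> {r..l}" "q \<in> {p..l}" for k p q
  proof -
    have "z p \<le> z q"
      using that by (intro mono_onD[OF mono]) auto
    then have "x k q \<le> x k p"
      unfolding x_def by (intro powr_mono) auto
    then show ?thesis
      unfolding m_def by (intro nat_mono ceiling_mono)
  qed
  have x_div: "x k p / (k + 2) ^ D = (real k + 2) powr - z p" for k p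
    by (simp add: x_def powr_diff powr_minus powr_realpow field_simps)
  have bounds: "((real k + 2) powr - z p / l) ^ p \<le> hom_density (complete_hypergraph r p) (G k)"
      "hom_density (complete_hypergraph r p) (G k) \<le> (2 * (real k + 2) powr - z p) ^ p"
    if p: "p \<in> {r..l}" for k p
  proof -
    have *: "2 \<le> r" "r \<le> p" "p \<le> l" "0 < (k + 2) ^ D" "m k p \<le> (k + 2) ^ D"
      using assms p m by auto
    have "(real k + 2) powr - z p / l \<le> m k p / ((k + 2) ^ D * real l)"
      unfolding x_div[symmetric] using m(1)[OF p, of k]
      by (simp add: divide_right_mono)
    then have "((real k + 2) powr - z p / l) ^ p \<le> (m k p / ((k + 2) ^ D * real l)) ^ p"
      by (intro power_mono) auto
    also have "\<dots> \<le> hom_density (complete_hypergraph r p) (G k)"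
      unfolding G_def using hom_density_layered_bounds(1)[where m = "m k", OF * anti[OF p]] by simp
    finally show "((real k + 2) powr - z p / l) ^ p \<le> hom_density (complete_hypergraph r p) (G k)" .
    have "hom_density (complete_hypergraph r p) (G k) \<le> (m k p / (k + 2) ^ D) ^ p"
      unfolding G_def using hom_density_layered_bounds(2)[where m = "m k", OF * anti[OF p]] by simp
    also have "m k p / (k + 2) ^ D \<le> 2 * (real k + 2) powr - z p"
      unfolding x_div[symmetric] using m(2)[OF p, of k] by (simp add: divide_right_mono)
    then have "(m k p / (k + 2) ^ D) ^ p \<le> (2 * (real k + 2) powr - z p) ^ p"
      by (intro power_mono) auto
    finally show "hom_density (complete_hypergraph r p) (G k) \<le> (2 * (real k + 2) powr - z p) ^ p" .
  qed
  have low_pos: "0 < ((real k + 2) powr - z p / l) ^ p" for k p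
    using assms by simp
  show ?thesis
  proof
    show "uniform_hypergraph r (G k)" for k
      unfolding G_def using assms by (intro uniform_layered_hypergraph) auto
    show pos: "0 < hom_density (complete_hypergraph r p) (G k)" if "p \<in> {r..l}" for k p
      using bounds(1)[OF that] low_pos less_le_trans by blast
    fix p assume p: "p \<in> {r..l}"
    let ?t = "\<lambda>k. hom_density (complete_hypergraph r p) (G k)"
    \<comment> \<open>Serves both sides of the sandwich: \<open>c = - ln l\<close> comes from the
      lower bound and \<open>c = ln 2\<close> from the rounding.\<close>
    have lim: "(\<lambda>k. p * (c / ln (real k + 2) - z p)) \<longlonglongrightarrow> - (p * z p)" for c
    proof -
      have "filterlim (\<lambda>k. ln (real k + 2)) at_top sequentially"
        using filterlim_compose[OF ln_at_top
            filterlim_tendsto_add_at_top[OF tendsto_const[of 2] filterlim_real_sequentially]]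
        by (simp add: add.commute)
      then have "(\<lambda>k. c / ln (real k + 2)) \<longlonglongrightarrow> 0"
        by (intro tendsto_divide_0[OF tendsto_const] filterlim_at_top_imp_at_infinity)
      then have "(\<lambda>k. p * (c / ln (real k + 2) - z p)) \<longlonglongrightarrow> p * (0 - z p)"
        by (intro tendsto_intros)
      then show ?thesis by simp
    qed
    show "(\<lambda>k. ln (?t k) / ln (real k + 2)) \<longlonglongrightarrow> - (p * z p)"
    proof (rule tendsto_sandwich[OF always_eventually always_eventually lim[of "- ln l"] lim[of "ln 2"]])
      show "\<forall>k. p * (- ln l / ln (real k + 2) - z p) \<le> ln (?t k) / ln (real k + 2)"
      proof
        fix k
        have "p * (- ln l - z p * ln (real k + 2)) = ln (((real k + 2) powr - z p / l) ^ p)"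
          using assms by (simp add: ln_realpow ln_div ln_powr)
        also have "\<dots> \<le> ln (?t k)"
          using bounds(1)[OF p] low_pos pos[OF p] by simp
        finally have "p * (- ln l - z p * ln (real k + 2)) / ln (real k + 2) \<le> ln (?t k) / ln (real k + 2)"
          by (intro divide_right_mono) auto
        then show "p * (- ln l / ln (real k + 2) - z p) \<le> ln (?t k) / ln (real k + 2)"
          by (simp add: diff_divide_distrib right_diff_distrib)
      qed
      show "\<forall>k. ln (?t k) / ln (real k + 2) \<le> p * (ln 2 / ln (real k + 2) - z p)"
      proof
        fix k
        have "ln (?t k) \<le> ln ((2 * (real k + 2) powr - z p) ^ p)"
          using bounds(2)[OF p] pos[OF p] by simp
        also have "\<dots> = p * (ln 2 - z p * ln (real k + 2))"
          by (simp add: ln_realpow ln_mult ln_powr right_diff_distrib)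
        finally have "ln (?t k) / ln (real k + 2) \<le> p * (ln 2 - z p * ln (real k + 2)) / ln (real k + 2)"
          by (intro divide_right_mono) auto
        then show "ln (?t k) / ln (real k + 2) \<le> p * (ln 2 / ln (real k + 2) - z p)"
          by (simp add: diff_divide_distrib right_diff_distrib)
      qed
    qed
  qed
qed

subsection \<open>Extreme rays of a simplicial cone\<close>

lemma conic_hull_singleton_iff: "x \<in> conic hull {u} \<longleftrightarrow> (\<exists>c\<ge>0. x = c *\<^sub>R u)"
  by (auto simp: conic_hull_explicit)

lemma conic_hull_scaleR:
  assumes "0 < d"
  shows "conic hull {d *\<^sub>R u} = conic hull {u}"
proof (intro equalityI subsetI)
  fix x assume "x \<in> conic hull {d *\<^sub>R u}"
  then obtain c where "0 \<le> c" "x = (c * d) *\<^sub>R u"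
    by (auto simp: conic_hull_singleton_iff)
  then show "x \<in> conic hull {u}"
    unfolding conic_hull_singleton_iff using assms by (intro exI[of _ "c * d"]) simp
next
  fix x assume "x \<in> conic hull {u}"
  then obtain c where "0 \<le> c" "x = c *\<^sub>R u"
    by (auto simp: conic_hull_singleton_iff)
  then show "x \<in> conic hull {d *\<^sub>R u}"
    unfolding conic_hull_singleton_iff using assms by (intro exI[of _ "c / d"]) simp
qed

text \<open>The functionals \<open>W i\<close> are coordinates with respect to the basis
  \<open>v i\<close>, and the cone is the nonnegative orthant in them, so its extreme rays are the
  coordinate axes.\<close>

lemma extreme_rays_dual_basis:
  fixes v :: "'i \<Rightarrow> 'a::real_vector" and W :: "'i \<Rightarrow> 'a \<Rightarrow> real"
  assumes "finite I" and lin: "\<And>i. i \<in> I \<Longrightarrow> linear (W i)"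
    and dual: "\<And>i j. i \<in> I \<Longrightarrow> j \<in> I \<Longrightarrow> W i (v j) = (if i = j then 1 else 0)"
    and expand: "\<And>x. x = (\<Sum>i\<in>I. W i x *\<^sub>R v i)"
  shows "{R. extreme_ray_of R {x. \<forall>i\<in>I. 0 \<le> W i x}} = {conic hull {v i} | i. i \<in> I}"
proof (intro equalityI subsetI)
  let ?C = "{x. \<forall>i\<in>I. 0 \<le> W i x}"
  fix R assume "R \<in> {R. extreme_ray_of R ?C}"
  then obtain u where u: "u \<noteq> 0" "R = conic hull {u}" and face: "R face_of ?C"
    by (auto simp: extreme_ray_of_def)
  have "u \<in> R"
    unfolding u(2) by (simp add: hull_inc)
  then have "u \<in> ?C"
    using face face_of_imp_subset by blast
  obtain i where i: "i \<in> I" "W i u \<noteq> 0"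
    using u(1) expand[of u] by (metis (no_types, lifting) scale_eq_0_iff sum.neutral)
  then have pos: "0 < W i u"
    using \<open>u \<in> ?C\<close> by (metis (mono_tags, lifting) mem_Collect_eq order_le_less)
  \<comment> \<open>\<open>u\<close> is the midpoint of \<open>a\<close> and \<open>b\<close>:
    \<open>a\<close> carries twice the \<open>i\<close>-th component of \<open>u\<close>, and
    \<open>b\<close> twice the remaining ones. The face property then puts \<open>a\<close>, a
    multiple of \<open>v i\<close>, on the ray.\<close>
  define a where "a = (2 * W i u) *\<^sub>R v i"
  define b where "b = 2 *\<^sub>R u - a"
  have Wa: "W j a = (if j = i then 2 * W i u else 0)" if "j \<in> I" for j
    using that i by (simp add: a_def linear_scale[OF lin] dual)
  have Wb: "W j b = (if j = i then 0 else 2 * W j u)" if "j \<in> I" for j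
    using that i Wa by (simp add: b_def linear_diff[OF lin] linear_scale[OF lin])
  have "a \<in> ?C" "b \<in> ?C"
    using \<open>u \<in> ?C\<close> by (auto simp: Wa Wb)
  moreover have "u \<in> open_segment a b"
  proof -
    have "a \<noteq> b"
      using Wa[OF i(1)] Wb[OF i(1)] pos by auto
    moreover have "u = (1 - 1 / 2) *\<^sub>R a + (1 / 2) *\<^sub>R b"
      by (simp add: b_def algebra_simps)
    ultimately show ?thesis
      unfolding in_segment by (metis half_gt_zero_iff less_numeral_extra(1) field_sum_of_halves
          less_add_same_cancel1)
  qed
  ultimately have "a \<in> R"
    using face \<open>u \<in> R\<close> by (auto dest: face_ofD)
  then obtain c where c: "0 \<le> c" "a = c *\<^sub>R u"
    unfolding u(2) conic_hull_singleton_iff by blast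
  have "a \<noteq> 0"
    using Wa[OF i(1)] pos linear_0[OF lin[OF i(1)]] by auto
  then have "0 < c"
    using c by (metis order_le_less scale_zero_left)
  have "u = (2 * W i u / c) *\<^sub>R v i"
    using c \<open>0 < c\<close> by (metis a_def divide_inverse_commute less_numeral_extra(3) scaleR_scaleR
        scale_one left_inverse)
  then have "R = conic hull {v i}"
    unfolding u(2) using conic_hull_scaleR[of "2 * W i u / c" "v i"] pos \<open>0 < c\<close> by simp
  then show "R \<in> {conic hull {v i} | i. i \<in> I}"
    using i by blast
next
  let ?C = "{x. \<forall>i\<in>I. 0 \<le> W i x}"
  fix R assume "R \<in> {conic hull {v i} | i. i \<in> I}"
  then obtain i where i: "i \<in> I" and R: "R = conic hull {v i}"
    by blast
  \<comment> \<open>The ray is the part of the cone where all coordinates other than the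
    \<open>i\<close>-th vanish; this form makes the face property easy to check.\<close>
  have R_iff: "x \<in> R \<longleftrightarrow> x \<in> ?C \<and> (\<forall>j\<in>I. j \<noteq> i \<longrightarrow> W j x = 0)" for x
  proof
    assume "x \<in> R"
    then show "x \<in> ?C \<and> (\<forall>j\<in>I. j \<noteq> i \<longrightarrow> W j x = 0)"
      using i by (auto simp: R conic_hull_singleton_iff linear_scale[OF lin] dual)
  next
    assume x: "x \<in> ?C \<and> (\<forall>j\<in>I. j \<noteq> i \<longrightarrow> W j x = 0)"
    have "x = (\<Sum>j\<in>I. if j = i then W i x *\<^sub>R v i else 0)"
      by (subst expand) (use x in \<open>auto intro!: sum.cong\<close>)
    then have "x = W i x *\<^sub>R v i"
      using \<open>finite I\<close> i by simp
    then show "x \<in> R"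
      unfolding R conic_hull_singleton_iff using x i by blast
  qed
  have "v i \<noteq> 0"
    using dual[OF i i] linear_0[OF lin[OF i]] by auto
  moreover have "R face_of ?C"
    unfolding face_of_def
  proof (intro conjI ballI impI)
    show "R \<subseteq> ?C"
      using R_iff by blast
    show "convex R"
      unfolding R by (simp add: convex_conic_hull)
    fix a b x assume ab: "a \<in> ?C" "b \<in> ?C" and x: "x \<in> R" "x \<in> open_segment a b"
    then obtain t where t: "0 < t" "t < 1" "x = (1 - t) *\<^sub>R a + t *\<^sub>R b"
      by (auto simp: in_segment)
    have "W j a = 0 \<and> W j b = 0" if "j \<in> I" "j \<noteq> i" for j
    proof -
      \<comment> \<open>Both weights are positive and both values nonnegative, so both values
        vanish.\<close>
      have "(1 - t) * W j a + t * W j b = 0"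
        using that x R_iff t linear_add[OF lin] linear_scale[OF lin] by auto
      moreover have "0 \<le> W j a" "0 \<le> W j b"
        using ab that by auto
      ultimately show ?thesis
        using t by (simp add: add_nonneg_eq_0_iff)
    qed
    then show "a \<in> R" "b \<in> R"
      using ab R_iff by auto
  qed
  ultimately show "R \<in> {R. extreme_ray_of R ?C}"
    unfolding extreme_ray_of_def using R by blast
qed

subsection \<open>The tropicalization\<close>

text \<open>The inequalities are kept in polynomial form, without logarithms, so that they cut out a
  closed set and survive the closure in the profile.\<close>

lemma density_profile_cliques_subset:
  fixes idx :: "nat \<Rightarrow> 'n::finite" and U :: "'n \<Rightarrow> nat hypergraph"
  assumes "2 \<le> r" "r \<le> l"
    and U: "\<And>p. p \<in> {r..l} \<Longrightarrow> U (idx p) = complete_hypergraph r p"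
  shows "density_profile r U \<subseteq> {Y. Y $ idx r \<le> 1} \<inter>
    (\<Inter>p\<in>{r..<l}. {Y. Y $ idx (Suc p) ^ p \<le> Y $ idx p ^ Suc p})" (is "_ \<subseteq> ?B")
  unfolding density_profile_def
proof (rule closure_minimal)
  show "closed ?B"
    by (intro closed_Int closed_INT ballI closed_Collect_le continuous_intros)
  show "{(\<chi> i. hom_density (U i) G) | G. uniform_hypergraph r G} \<subseteq> ?B"
    using assms hom_density_clique_power_le[of r]
      hom_density_le_1[of r _ "complete_hypergraph r r"]
    by (auto simp: complete_hypergraph_def)
qed

text \<open>Logarithms turn the polynomial inequalities into linear ones; the positive factor
  \<open>- 1 / ln (\<tau> k)\<close> and the limit preserve these.\<close>

lemma trop_cliques_subset:
  fixes idx :: "nat \<Rightarrow> 'n::finite" and U :: "'n \<Rightarrow> nat hypergraph"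
  assumes "2 \<le> r" "r \<le> l"
    and U: "\<And>p. p \<in> {r..l} \<Longrightarrow> U (idx p) = complete_hypergraph r p"
    and y: "y \<in> trop (density_profile r U)"
  shows "y $ idx r \<le> 0"
    and "p \<in> {r..<l} \<Longrightarrow> real p * y $ idx (Suc p) \<le> real (Suc p) * y $ idx p"
proof -
  obtain \<tau> Y where \<tau>: "\<And>k. 0 < \<tau> k" "\<And>k. \<tau> k < 1"
    and Y: "\<And>k. Y k \<in> density_profile r U" "\<And>k i. 0 < Y k $ i"
    and lim: "(\<lambda>k. (- 1 / ln (\<tau> k)) *\<^sub>R (\<chi> i. ln (Y k $ i))) \<longlonglongrightarrow> y"
    using y unfolding trop_def by blast
  define s where "s k = - 1 / ln (\<tau> k)" for k
  have s: "0 < s k" for k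
    using \<tau>[of k] unfolding s_def by (simp add: divide_pos_neg)
  have lim_nth: "(\<lambda>k. s k * ln (Y k $ i)) \<longlonglongrightarrow> y $ i" for i
    using tendsto_vec_nth[OF lim, of i] by (simp add: s_def)
  note Y_in = subsetD[OF density_profile_cliques_subset[OF assms(1,2) U] Y(1)]
  show "y $ idx r \<le> 0"
  proof (rule LIMSEQ_le_const2[OF lim_nth])
    have "s k * ln (Y k $ idx r) \<le> 0" for k
      using Y_in[of k] s[of k] Y(2)[of k "idx r"] by (auto simp: mult_le_0_iff)
    then show "\<exists>N. \<forall>k\<ge>N. s k * ln (Y k $ idx r) \<le> 0"
      by blast
  qed
  assume p: "p \<in> {r..<l}"
  show "real p * y $ idx (Suc p) \<le> real (Suc p) * y $ idx p"
  proof (rule LIMSEQ_le[OF tendsto_mult_left[OF lim_nth] tendsto_mult_left[OF lim_nth]])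
    have "p * (s k * ln (Y k $ idx (Suc p))) \<le> Suc p * (s k * ln (Y k $ idx p))" for k
    proof -
      have "ln (Y k $ idx (Suc p) ^ p) \<le> ln (Y k $ idx p ^ Suc p)"
        using Y_in[of k] p Y(2) by (subst ln_le_cancel_iff) auto
      then have "p * ln (Y k $ idx (Suc p)) \<le> Suc p * ln (Y k $ idx p)"
        using Y(2) by (simp only: ln_realpow)
      then show ?thesis
        using mult_left_mono[OF _ less_imp_le[OF s[of k]]] by (metis mult.left_commute)
    qed
    then show "\<exists>N. \<forall>k\<ge>N. p * (s k * ln (Y k $ idx (Suc p))) \<le> Suc p * (s k * ln (Y k $ idx p))"
      by blast
  qed
qed

text \<open>The inequalities on \<open>y\<close> say that \<open>z p = - y $ idx p / p\<close> is
  nonnegative at \<open>r\<close> and increases with \<open>p\<close>, as the layered construction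
  requires.\<close>

lemma in_trop_cliques:
  fixes idx :: "nat \<Rightarrow> 'n::finite" and U :: "'n \<Rightarrow> nat hypergraph"
  assumes "2 \<le> r" "r \<le> l" and surj: "idx ` {r..l} = UNIV"
    and U: "\<And>p. p \<in> {r..l} \<Longrightarrow> U (idx p) = complete_hypergraph r p"
    and y: "y $ idx r \<le> 0"
      "\<And>p. p \<in> {r..<l} \<Longrightarrow> real p * y $ idx (Suc p) \<le> real (Suc p) * y $ idx p"
  shows "y \<in> trop (density_profile r U)"
proof -
  define z where "z p = - y $ idx p / p" for p
  have mono_z: "mono_on {r..l} z"
  proof (rule mono_onI)
    fix p q assume "p \<in> {r..l}" "q \<in> {r..l}" "p \<le> q"
    from \<open>p \<le> q\<close> \<open>q \<in> {r..l}\<close> show "z p \<le> z q"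
    proof (induction q rule: dec_induct)
      case (step q)
      have "0 < q"
        using \<open>p \<in> {r..l}\<close> step assms(1) by auto
      then have "z q \<le> z (Suc q)"
        using y(2)[of q] \<open>p \<in> {r..l}\<close> step by (simp add: z_def field_simps)
      then show ?case
        using step \<open>p \<in> {r..l}\<close> by auto
    qed simp
  qed
  have z_r: "0 \<le> z r"
    using y(1) by (simp add: z_def divide_nonpos_nonneg)
  obtain G :: "nat \<Rightarrow> nat hypergraph"
    where G: "\<And>k. uniform_hypergraph r (G k)"
    and pos: "\<And>k p. p \<in> {r..l} \<Longrightarrow> 0 < hom_density (complete_hypergraph r p) (G k)"
    and lim: "\<And>p. p \<in> {r..l} \<Longrightarrow>
      (\<lambda>k. ln (hom_density (complete_hypergraph r p) (G k)) / ln (real k + 2)) \<longlonglongrightarrow> - (p * z p)"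
    by (rule layered_density_limits[OF assms(1,2) z_r mono_z]) blast
  \<comment> \<open>With this choice \<open>- 1 / ln (\<tau> k)\<close> is
    \<open>1 / ln (real k + 2)\<close>, the scaling in \<open>lim\<close>.\<close>
  define \<tau> where "\<tau> k = 1 / (real k + 2)" for k
  define Y where "Y k = (\<chi> i. hom_density (U i) (G k))" for k
  have Y_nth: "Y k $ idx p = hom_density (complete_hypergraph r p) (G k)" if "p \<in> {r..l}" for k p
    using that by (simp add: Y_def U)
  have ex: "\<exists>p\<in>{r..l}. i = idx p" for i
    using surj by blast
  have "\<forall>k. 0 < \<tau> k \<and> \<tau> k < 1"
    by (simp add: \<tau>_def)
  moreover have "\<tau> \<longlonglongrightarrow> 0"
    unfolding \<tau>_def using LIMSEQ_ignore_initial_segment[OF lim_inverse_n', of 2]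
    by (simp add: add.commute)
  moreover have "\<forall>k. Y k \<in> density_profile r U \<and> (\<forall>i. 0 < Y k $ i)"
  proof (intro allI conjI)
    show "Y k \<in> density_profile r U" for k
      unfolding density_profile_def Y_def using G by (intro subsetD[OF closure_subset]) blast
    show "0 < Y k $ i" for k i
      using ex[of i] pos Y_nth by auto
  qed
  moreover have "(\<lambda>k. (- 1 / ln (\<tau> k)) *\<^sub>R (\<chi> i. ln (Y k $ i))) \<longlonglongrightarrow> y"
  proof (rule vec_tendstoI)
    fix i
    obtain p where p: "p \<in> {r..l}" "i = idx p"
      using ex by blast
    have "- (p * z p) = y $ i"
      using p assms(1) by (simp add: z_def)
    then show "(\<lambda>k. ((- 1 / ln (\<tau> k)) *\<^sub>R (\<chi> i. ln (Y k $ i))) $ i) \<longlonglongrightarrow> y $ i"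
      using lim[OF p(1)] p by (simp add: Y_nth \<tau>_def ln_div)
  qed
  ultimately show ?thesis
    unfolding trop_def by blast
qed

section \<open>The cone in dual coordinates and its extreme rays\<close>

theorem theorem3p3:
  fixes r l :: nat
    and idx :: "nat \<Rightarrow> 'n::finite"
    and U :: "'n \<Rightarrow> nat hypergraph"
  assumes "r \<ge> 2" and "l \<ge> r"
    and "bij_betw idx {r..l} (UNIV :: 'n set)"
    and "\<And>p. p \<in> {r..l} \<Longrightarrow> U (idx p) = complete_hypergraph r p"
  shows "trop (density_profile r U) =
           {y. y $ idx r \<le> 0 \<and>
               (\<forall>i\<in>{1..l - r}.
                  real (r + i) * y $ idx (r + i - 1) - real (r + i - 1) * y $ idx (r + i) \<ge> 0)}
       \<and> {R. extreme_ray_of R (trop (density_profile r U))} =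
           {conic hull {- (\<Sum>j = i..l - r + 1. real (r + j - 1) *\<^sub>R axis (idx (r + j - 1)) 1)} | i.
              i \<in> {1..l - r + 1}}"
proof -
  let ?C = "{y. y $ idx r \<le> 0 \<and>
    (\<forall>i\<in>{1..l - r}.
       real (r + i) * y $ idx (r + i - 1) - real (r + i - 1) * y $ idx (r + i) \<ge> 0)}"
  have surj: "idx ` {r..l} = UNIV" and inj: "inj_on idx {r..l}"
    using assms(3) by (auto simp: bij_betw_def)
  have trop: "trop (density_profile r U) = ?C"
  proof (intro equalityI subsetI)
    fix y assume y: "y \<in> trop (density_profile r U)"
    have "real (r + i) * y $ idx (r + i - 1) - real (r + i - 1) * y $ idx (r + i) \<ge> 0"
      if "i \<in> {1..l - r}" for i
    proof -
      have "Suc (r + i - 1) = r + i" "r + i - 1 \<in> {r..<l}"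
        using that by auto
      then show ?thesis
        using trop_cliques_subset(2)[OF assms(1,2,4) y, of "r + i - 1"] by simp
    qed
    then show "y \<in> ?C"
      using trop_cliques_subset(1)[OF assms(1,2,4) y] by blast
  next
    fix y assume y: "y \<in> ?C"
    have "real p * y $ idx (Suc p) \<le> real (Suc p) * y $ idx p" if "p \<in> {r..<l}" for p
    proof -
      have "Suc p - r \<in> {1..l - r}" "r + (Suc p - r) = Suc p"
        using that by auto
      then show ?thesis
        using y by fastforce
    qed
    then show "y \<in> trop (density_profile r U)"
      using y by (intro in_trop_cliques[OF assms(1,2) surj assms(4)]) auto
  qed
  define I where "I = {1..l - r + 1}"
  define v where "v i = - (\<Sum>j = i..l - r + 1. real (r + j - 1) *\<^sub>R axis (idx (r + j - 1)) (1::real))"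
    for i
  \<comment> \<open>With \<open>z p = - y $ idx p / p\<close>, \<open>W 1\<close> is
    \<open>z r\<close> and every other \<open>W i\<close> is the increment
    \<open>z (r + i - 1) - z (r + i - 2)\<close>. The index 1 is separate because
    \<open>r - 1\<close> indexes no coordinate.\<close>
  define W where "W i y = (if i = 1 then - y $ idx r / r
      else y $ idx (r + i - 2) / real (r + i - 2) - y $ idx (r + i - 1) / real (r + i - 1))"
    for i and y :: "real ^ 'n"
  have I_idx: "\<exists>k\<in>I. a = idx (r + k - 1)" for a
  proof -
    obtain p where "p \<in> {r..l}" "a = idx p"
      using surj by blast
    then show ?thesis
      by (intro bexI[of _ "p - r + 1"]) (auto simp: I_def)
  qed
  have v_nth: "v i $ idx (r + k - 1) = (if i \<le> k then - real (r + k - 1) else 0)"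
    if k: "k \<in> I" and i: "i \<in> I" for i k
  proof -
    have "idx (r + k - 1) = idx (r + j - 1) \<longleftrightarrow> j = k" if "j \<in> {i..l - r + 1}" for j
    proof -
      have "r + j - 1 \<in> {r..l}" "r + k - 1 \<in> {r..l}" "r + k - 1 = r + j - 1 \<longleftrightarrow> j = k"
        using that i k assms(2) unfolding I_def atLeastAtMost_iff by arith+
      then show ?thesis
        by (simp add: inj_on_eq_iff[OF inj])
    qed
    then have "(\<Sum>j = i..l - r + 1. (real (r + j - 1) *\<^sub>R axis (idx (r + j - 1)) 1) $ idx (r + k - 1))
        = (\<Sum>j = i..l - r + 1. if j = k then real (r + k - 1) else 0)"
      by (intro sum.cong refl) (simp only: vector_scaleR_component axis_def vec_lambda_beta, auto)
    then have "v i $ idx (r + k - 1) = - (\<Sum>j = i..l - r + 1. if j = k then real (r + k - 1) else 0)"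
      by (simp only: v_def vector_uminus_component sum_component)
    also have "\<dots> = (if i \<le> k then - real (r + k - 1) else 0)"
      using k by (auto simp: I_def)
    finally show ?thesis .
  qed
  \<comment> \<open>Telescoping: the increments up to \<open>k\<close> add up to
    \<open>z (r + k - 1)\<close>.\<close>
  have W_sum: "(\<Sum>i = 1..k. W i y) = - y $ idx (r + k - 1) / real (r + k - 1)" if "1 \<le> k" for k y
    using that
  proof (induction k rule: dec_induct)
    case (step k)
    then show ?case by (simp add: W_def)
  qed (simp add: W_def)
  have C: "?C = {y. \<forall>i\<in>I. 0 \<le> W i y}"
  proof -
    \<comment> \<open>The index 1 gives the sign condition, and \<open>Suc i\<close> gives the
      \<open>i\<close>-th inequality after clearing denominators.\<close>
    have "I = insert 1 (Suc ` {1..l - r})"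
      by (auto simp: I_def image_Suc_atLeastAtMost)
    moreover have "0 \<le> W 1 y \<longleftrightarrow> y $ idx r \<le> 0" for y
      using assms(1) by (simp add: W_def divide_le_0_iff)
    moreover have "0 \<le> W (Suc i) y \<longleftrightarrow>
      real (r + i) * y $ idx (r + i - 1) - real (r + i - 1) * y $ idx (r + i) \<ge> 0"
      if "i \<in> {1..l - r}" for i y
    proof -
      have "0 < real (r + i - 1)" "0 < real (r + i)"
        using assms(1) by auto
      moreover have "0 \<le> A / a - B / c \<longleftrightarrow> c * A - a * B \<ge> 0"
        if "0 < a" "0 < c" for a c A B :: real
        using that by (simp add: pos_divide_le_eq pos_le_divide_eq mult.commute)
      moreover have "W (Suc i) y = y $ idx (r + i - 1) / real (r + i - 1) - y $ idx (r + i) / real (r + i)"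
        using that by (simp add: W_def)
      ultimately show ?thesis
        by (simp only:)
    qed
    ultimately show ?thesis
      by (simp only: ball_simps cong: ball_cong)
  qed
  have "{R. extreme_ray_of R {y. \<forall>i\<in>I. 0 \<le> W i y}} = {conic hull {v i} | i. i \<in> I}"
  proof (rule extreme_rays_dual_basis)
    show "linear (W i)" for i
      by (rule linearI) (auto simp: W_def add_divide_distrib diff_divide_distrib algebra_simps)
    show "W i (v j) = (if i = j then 1 else 0)" if i: "i \<in> I" and j: "j \<in> I" for i j
    proof -
      \<comment> \<open>In the coordinates \<open>z\<close>, \<open>v j\<close> is the step function
        that jumps from 0 to 1 at position \<open>j\<close>, so its only nonzero increment is the
        \<open>j\<close>-th.\<close>
      have v_div: "v j $ idx (r + k - 1) / real (r + k - 1) = (if j \<le> k then - 1 else 0)"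
        if "k \<in> I" for k
      proof -
        have "real (r + k - 1) \<noteq> 0"
          using assms(1) by simp
        then show ?thesis
          unfolding v_nth[OF that j] by (cases "j \<le> k") (simp_all del: of_nat_diff of_nat_add)
      qed
      show ?thesis
      proof (cases "i = 1")
        case True
        then show ?thesis
          using v_div[OF i] j by (auto simp: W_def I_def)
      next
        case False
        then have "i - 1 \<in> I" "r + (i - 1) - 1 = r + i - 2"
          using i by (auto simp: I_def)
        then have "W i (v j) = (if j \<le> i - 1 then - 1 else 0) - (if j \<le> i then - 1 else 0)"
          using v_div[OF i] v_div[of "i - 1"] False by (simp only: W_def if_False)
        then show ?thesis
          using False i by (auto simp: I_def)
      qed
    qed
    show "y = (\<Sum>i\<in>I. W i y *\<^sub>R v i)" for y
    proof (rule vec_eq_iff[THEN iffD2, rule_format])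
      fix a
      obtain k where k: "k \<in> I" "a = idx (r + k - 1)"
        using I_idx by blast
      \<comment> \<open>Only the \<open>v i\<close> with \<open>i \<le> k\<close> reach coordinate
        \<open>k\<close>, which leaves the partial sum evaluated by \<open>W_sum\<close>.\<close>
      have "(\<Sum>i\<in>I. W i y *\<^sub>R v i) $ a = (\<Sum>i\<in>I. if i \<le> k then W i y * - real (r + k - 1) else 0)"
        unfolding sum_component vector_scaleR_component k(2)
        by (intro sum.cong refl) (simp only: v_nth[OF k(1)] real_scaleR_def split: if_split, simp)
      also have "\<dots> = (\<Sum>i = 1..k. W i y * - real (r + k - 1))"
        using k by (intro sum.mono_neutral_cong_right) (auto simp: I_def)
      also have "\<dots> = (- y $ a / real (r + k - 1)) * - real (r + k - 1)"
        using k by (simp only: sum_distrib_right[symmetric] W_sum I_def atLeastAtMost_iff)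
      also have "\<dots> = y $ a"
        using assms(1) by (simp del: of_nat_diff of_nat_add)
      finally show "y $ a = (\<Sum>i\<in>I. W i y *\<^sub>R v i) $ a" ..
    qed
  qed (simp add: I_def)
  then show ?thesis
    unfolding trop C v_def I_def by blast
qed

end
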